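(* Let $\{W_j\}_{j\in J}$ be a complete sequence of closed subspaces of $\mathcal{H}$. Then $\{W_j\}_{j\in J}$ is an $f$-basis for $\mathcal{H}$ if and only if there exists a constant $M$ such that $$\Big\|\sum_{j\in F}g_j\Big\|\leq M\Big\|\sum_{j\in G}g_j\Big\|$$ for all finite subsets $F\subset G\subset J$ and arbitrary vectors $g_j\in W_j$.
   Context: $\mathcal{H}$ is a separable Hilbert space and $J$ is a countable (or finite) index set. A sequence $\{W_j\}_{j\in J}$ of closed subspaces of $\mathcal{H}$ is an $f$-basis (fusion Schauder basis) for $\mathcal{H}$ if for every $f\in\mathcal{H}$ there exists a unique sequence $\{g_j\}_{j\in J}$ with $g_j\in W_j$ such that $f=\sum_{j\in J}g_j$, with convergence in norm. The sequence $\{W_j\}_{j\in J}$ is complete for $\mathcal{H}$ if $\mathcal{H}=\overline{\operatorname{span}}\{W_j\}_{j\in J}$. *)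

theory Defs
  imports "HOL-Analysis.Analysis"
begin

text \<open>
  A Hilbert space over a scalar field \<open>'k\<close>, which is \<open>real\<close> or \<open>complex\<close>: up to isomorphism there is
  no other \<^class>\<open>real_normed_field\<close>.  Type class \<^class>\<open>real_inner\<close> supplies the underlying real
  Hilbert space.  For complex scalars its inner product is the real part of the Hermitian one,
  which is recovered from it as \<open>\<langle>x, y\<rangle> = inner x y + \<i> * inner x (\<i> y)\<close> (linear in the first
  argument); \<open>norm_scale\<close> makes multiplication by \<open>\<i>\<close> an isometry, as this formula requires.
\<close>

locale hilbert_space = vector_space scl
  for scl :: "'k::real_normed_field \<Rightarrow> 'h::{real_inner, complete_space} \<Rightarrow> 'h" +
  assumes scale_of_real: "scl (of_real r) x = r *\<^sub>R x"
    and norm_scale: "norm (scl c x) = norm c * norm x"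

lemma hilbert_space_scaleR:
  "hilbert_space (scaleR :: real \<Rightarrow> 'h::{real_inner, complete_space} \<Rightarrow> 'h)"
  by unfold_locales (auto simp: algebra_simps)

lemma hilbert_space_complex: "hilbert_space (times :: complex \<Rightarrow> complex \<Rightarrow> complex)"
  by unfold_locales (auto simp: algebra_simps norm_mult scaleR_conv_of_real)

definition closed_subspace :: "('k::real_normed_field \<Rightarrow> 'h::{real_inner, complete_space} \<Rightarrow> 'h) \<Rightarrow> 'h set \<Rightarrow> bool"
  where "closed_subspace scl W \<longleftrightarrow> module.subspace scl W \<and> closed W"

definition complete_family :: "('k::real_normed_field \<Rightarrow> 'h::{real_inner, complete_space} \<Rightarrow> 'h) \<Rightarrow>
    'j set \<Rightarrow> ('j \<Rightarrow> 'h set) \<Rightarrow> bool"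
  where "complete_family scl J W \<longleftrightarrow> closure (module.span scl (\<Union>j\<in>J. W j)) = UNIV"

text \<open>
  The index set carries no order, so the expansion is an unordered sum: \<open>has_sum\<close> is norm
  convergence of the net of finite partial sums, that is, unconditional convergence.  Membership in
  \<open>PiE\<close> fixes the values of \<open>g\<close> outside \<open>J\<close>, so uniqueness concerns only the family indexed by \<open>J\<close>.
\<close>

definition f_basis :: "('k::real_normed_field \<Rightarrow> 'h::{real_inner, complete_space} \<Rightarrow> 'h) \<Rightarrow>
    'j set \<Rightarrow> ('j \<Rightarrow> 'h set) \<Rightarrow> bool"
  where "f_basis scl J W \<longleftrightarrow>
    (\<forall>j\<in>J. closed_subspace scl (W j)) \<and>
    (\<forall>f. \<exists>!g. g \<in> (\<Pi>\<^sub>E j\<in>J. W j) \<and> (g has_sum f) J)"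

end

theory Submission
  imports Defs
begin

text \<open>
  The norm of an expansion is the supremum of the norms of its finite partial sums.  If every vector
  has an expansion, Baire's theorem makes the closure of some set of vectors with expansions of norm
  at most \<open>c\<close> contain a ball around \<open>0\<close>, and the iteration from the proof of the open mapping theorem
  removes the closure: each \<open>f\<close> has an expansion of norm at most \<open>M * norm f\<close>.  Uniqueness
  identifies it with any given finite expansion of \<open>f\<close>.  Conversely, the inequality makes the
  expansions of a convergent sequence of finite sums uniformly Cauchy, so existence passes from the
  span to its closure; uniqueness is the case of a singleton \<open>F\<close>, with the sums over \<open>G\<close> tending
  to \<open>0\<close>.
\<close>

section \<open>Limits and bounds for unordered sums\<close>

text \<open>The index \<open>N\<close> does not depend on \<open>F\<close>, so the limit in
  \<open>n\<close> can be exchanged with the limit over finite subsets. Singletons \<open>F\<close>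
  give the limit in each coordinate. Both directions construct their expansions this way.\<close>

lemma has_sum_limit_of_uniformly_Cauchy:
  fixes p :: "nat \<Rightarrow> 'j \<Rightarrow> 'h::{real_normed_vector, complete_space}"
  assumes p: "\<And>n. (p n has_sum s n) J"
    and s: "s \<longlonglongrightarrow> f"
    and Cauchy: "\<And>e. e > 0 \<Longrightarrow> \<exists>N. \<forall>n\<ge>N. \<forall>m\<ge>n. \<forall>F. finite F \<and> F \<subseteq> J \<longrightarrow>
      norm (sum (p n) F - sum (p m) F) \<le> e"
  obtains g where "(g has_sum f) J" "\<And>j. j \<in> J \<Longrightarrow> (\<lambda>n. p n j) \<longlonglongrightarrow> g j"
proof -
  have "convergent (\<lambda>n. p n j)" if "j \<in> J" for j
  proof (rule Cauchy_convergent, rule CauchyI')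
    fix e :: real
    assume "e > 0"
    then obtain N where N: "\<forall>n\<ge>N. \<forall>m\<ge>n. \<forall>F. finite F \<and> F \<subseteq> J \<longrightarrow>
        norm (sum (p n) F - sum (p m) F) \<le> e / 2"
      using Cauchy[of "e / 2"] by auto
    have "dist (p m j) (p n j) < e" if "m \<ge> N" "n > m" for m n
    proof -
      have "norm (p m j - p n j) \<le> e / 2"
        using N[rule_format, of m n "{j}"] that \<open>j \<in> J\<close> by simp
      then show ?thesis
        using \<open>e > 0\<close> unfolding dist_norm by linarith
    qed
    then show "\<exists>M. \<forall>m\<ge>M. \<forall>n>m. dist (p m j) (p n j) < e"
      by blast
  qed
  then obtain g where g: "\<And>j. j \<in> J \<Longrightarrow> (\<lambda>n. p n j) \<longlonglongrightarrow> g j"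
    unfolding convergent_def by metis
  have "(g has_sum f) J"
    unfolding has_sum_def tendsto_iff
  proof (intro allI impI)
    fix e :: real
    assume "e > 0"
    then obtain N1 where N1: "\<And>n m F. n \<ge> N1 \<Longrightarrow> m \<ge> n \<Longrightarrow> finite F \<Longrightarrow> F \<subseteq> J \<Longrightarrow>
        norm (sum (p n) F - sum (p m) F) \<le> e / 4"
      using Cauchy[of "e / 4"] by (meson divide_pos_pos zero_less_numeral)
    obtain N2 where N2: "\<And>n. n \<ge> N2 \<Longrightarrow> dist (s n) f < e / 4"
      using s \<open>e > 0\<close> unfolding lim_sequentially by (meson zero_less_divide_iff zero_less_numeral)
    \<comment> \<open>This \<open>n\<close> is fixed before \<open>F\<close>, so that the set of
      \<open>F\<close> with a good partial sum of \<open>p n\<close> depends on \<open>e\<close>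
      alone.\<close>
    define n where "n = max N1 N2"
    have "\<forall>\<^sub>F F in finite_subsets_at_top J. dist (sum (p n) F) (s n) < e / 4"
      using p[of n] \<open>e > 0\<close> unfolding has_sum_def by (intro tendstoD) auto
    moreover have "\<forall>\<^sub>F F in finite_subsets_at_top J. finite F \<and> F \<subseteq> J"
      by auto
    ultimately show "\<forall>\<^sub>F F in finite_subsets_at_top J. dist (sum g F) f < e"
    proof eventually_elim
      case (elim F)
      \<comment> \<open>For a fixed finite \<open>F\<close> the coordinate limits add up, and the
        Cauchy estimate survives letting \<open>m\<close> tend to infinity.\<close>
      have "(\<lambda>m. sum (p n) F - sum (p m) F) \<longlonglongrightarrow> sum (p n) F - sum g F"
        using elim g by (intro tendsto_intros) auto
      then have "norm (sum (p n) F - sum g F) \<le> e / 4"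
        by (rule Lim_bounded[OF tendsto_norm, of _ _ n]) (use elim N1 n_def in auto)
      then have "dist (sum g F) (sum (p n) F) \<le> e / 4"
        by (simp add: dist_norm norm_minus_commute)
      moreover have "dist (sum g F) f \<le> dist (sum g F) (sum (p n) F) + dist (sum (p n) F) (s n) + dist (s n) f"
        by metric
      moreover have "dist (s n) f < e / 4"
        using N2 n_def by simp
      ultimately show ?case
        using elim \<open>e > 0\<close> by linarith
    qed
  qed
  then show ?thesis
    using g that by blast
qed

text \<open>Convergence controls only the sums over finite sets containing some \<open>A\<close>.
  Enlarging \<open>F\<close> to \<open>F \<union> A\<close> costs the sum over \<open>A - F\<close>,
  which is bounded independently of \<open>F\<close>.\<close>

lemma has_sum_finite_sums_bounded:
  fixes g :: "'j \<Rightarrow> 'h::real_normed_vector"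
  assumes "(g has_sum f) J"
  obtains c where "\<And>F. finite F \<Longrightarrow> F \<subseteq> J \<Longrightarrow> norm (sum g F) \<le> c"
proof -
  have "\<forall>\<^sub>F F in finite_subsets_at_top J. dist (sum g F) f < 1"
    using assms unfolding has_sum_def tendsto_iff by simp
  then obtain A where A: "finite A" "A \<subseteq> J"
    and near: "\<And>F. finite F \<Longrightarrow> A \<subseteq> F \<Longrightarrow> F \<subseteq> J \<Longrightarrow> dist (sum g F) f < 1"
    unfolding eventually_finite_subsets_at_top by metis
  have "norm (sum g F) \<le> norm f + 1 + (\<Sum>j\<in>A. norm (g j))" if F: "finite F" "F \<subseteq> J" for F
  proof -
    have "sum g F = sum g (F \<union> A) - sum g (A - F)"
      using sum.subset_diff[of F "F \<union> A" g] F A by (simp add: Un_Diff)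
    then have "norm (sum g F) \<le> norm (sum g (F \<union> A)) + norm (sum g (A - F))"
      by (simp add: norm_triangle_ineq4)
    also have "norm (sum g (F \<union> A)) \<le> norm f + 1"
      using near[of "F \<union> A"] F A norm_triangle_sub[of "sum g (F \<union> A)" f]
      by (simp add: dist_norm)
    also have "norm (sum g (A - F)) \<le> (\<Sum>j\<in>A. norm (g j))"
      using A by (intro order.trans[OF norm_sum] sum_mono2) auto
    finally show ?thesis
      by simp
  qed
  then show ?thesis
    using that by blast
qed

section \<open>Vectors with an expansion of bounded norm\<close>

text \<open>A sublevel set of the expansion norm, with the supremum replaced by a bound on every
  partial sum. Some expansion has to satisfy the bound, since uniqueness is not yet available. For
  negative \<open>c\<close> the set is empty, by \<open>F = {}\<close>.\<close>

definition bounded_expansions ::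
    "'j set \<Rightarrow> ('j \<Rightarrow> 'h::real_normed_vector set) \<Rightarrow> real \<Rightarrow> 'h set" where
  "bounded_expansions J W c = {f. \<exists>g. (\<forall>j\<in>J. g j \<in> W j) \<and> (g has_sum f) J \<and>
    (\<forall>F. finite F \<and> F \<subseteq> J \<longrightarrow> norm (sum g F) \<le> c)}"

lemma bounded_expansionsI:
  assumes "\<And>j. j \<in> J \<Longrightarrow> g j \<in> W j" "(g has_sum f) J"
    and "\<And>F. finite F \<Longrightarrow> F \<subseteq> J \<Longrightarrow> norm (sum g F) \<le> c"
  shows "f \<in> bounded_expansions J W c"
  using assms unfolding bounded_expansions_def by blast

lemma bounded_expansionsE:
  assumes "f \<in> bounded_expansions J W c"
  obtains g where "\<And>j. j \<in> J \<Longrightarrow> g j \<in> W j" "(g has_sum f) J"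
    "\<And>F. finite F \<Longrightarrow> F \<subseteq> J \<Longrightarrow> norm (sum g F) \<le> c"
  using assms unfolding bounded_expansions_def by blast

lemma bounded_expansions_mono:
  assumes "a \<le> b"
  shows "bounded_expansions J W a \<subseteq> bounded_expansions J W b"
proof
  fix x
  assume "x \<in> bounded_expansions J W a"
  then show "x \<in> bounded_expansions J W b"
    by (rule bounded_expansionsE, intro bounded_expansionsI) (use assms order.trans in blast)+
qed

lemma bounded_expansions_diff:
  assumes W: "\<And>j. j \<in> J \<Longrightarrow> subspace (W j)"
    and x: "x \<in> bounded_expansions J W a" and y: "y \<in> bounded_expansions J W b"
  shows "x - y \<in> bounded_expansions J W (a + b)"
proof -
  obtain g where g: "\<And>j. j \<in> J \<Longrightarrow> g j \<in> W j" "(g has_sum x) J"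
      "\<And>F. finite F \<Longrightarrow> F \<subseteq> J \<Longrightarrow> norm (sum g F) \<le> a"
    using x by (rule bounded_expansionsE) blast
  obtain h where h: "\<And>j. j \<in> J \<Longrightarrow> h j \<in> W j" "(h has_sum y) J"
      "\<And>F. finite F \<Longrightarrow> F \<subseteq> J \<Longrightarrow> norm (sum h F) \<le> b"
    using y by (rule bounded_expansionsE) blast
  show ?thesis
  proof (rule bounded_expansionsI)
    have "((\<lambda>j. g j + - h j) has_sum (x + - y)) J"
      using g(2) h(2) by (intro has_sum_add) (simp_all add: has_sum_uminus)
    then show "((\<lambda>j. g j - h j) has_sum (x - y)) J"
      by simp
    show "g j - h j \<in> W j" if "j \<in> J" for j
      using g(1) h(1) W that by (intro subspace_diff)
    show "norm (\<Sum>j\<in>F. g j - h j) \<le> a + b" if "finite F" "F \<subseteq> J" for F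
      using g(3)[OF that] h(3)[OF that] norm_triangle_ineq4[of "sum g F" "sum h F"]
      by (simp add: sum_subtractf)
  qed
qed

lemma bounded_expansions_scaleR:
  assumes W: "\<And>j. j \<in> J \<Longrightarrow> subspace (W j)"
    and x: "x \<in> bounded_expansions J W a"
  shows "r *\<^sub>R x \<in> bounded_expansions J W (\<bar>r\<bar> * a)"
proof -
  obtain g where g: "\<And>j. j \<in> J \<Longrightarrow> g j \<in> W j" "(g has_sum x) J"
      "\<And>F. finite F \<Longrightarrow> F \<subseteq> J \<Longrightarrow> norm (sum g F) \<le> a"
    using x by (rule bounded_expansionsE) blast
  show ?thesis
  proof (rule bounded_expansionsI)
    show "((\<lambda>j. r *\<^sub>R g j) has_sum (r *\<^sub>R x)) J"
      using g(2) by (rule has_sum_scaleR)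
    show "r *\<^sub>R g j \<in> W j" if "j \<in> J" for j
      using g(1) W that by (intro subspace_scale)
    show "norm (\<Sum>j\<in>F. r *\<^sub>R g j) \<le> \<bar>r\<bar> * a" if "finite F" "F \<subseteq> J" for F
      using g(3)[OF that] by (simp flip: scaleR_sum_right add: mult_left_mono)
  qed
qed

section \<open>Baire's theorem and the open mapping iteration\<close>

lemma ball_subset_closure_bounded_expansions:
  fixes W :: "'j \<Rightarrow> 'h::{real_normed_vector, complete_space} set"
  assumes W: "\<And>j. j \<in> J \<Longrightarrow> subspace (W j)"
    and ex: "\<And>f. \<exists>g. (\<forall>j\<in>J. g j \<in> W j) \<and> (g has_sum f) J"
  obtains c r where "r > 0" "ball 0 r \<subseteq> closure (bounded_expansions J W c)"
proof -
  let ?B = "\<lambda>n. bounded_expansions J W (real n)"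
  have "x \<in> (\<Union>n. closure (?B n))" for x
  proof -
    obtain g where g: "\<forall>j\<in>J. g j \<in> W j" "(g has_sum x) J"
      using ex by blast
    obtain c where c: "\<And>F. finite F \<Longrightarrow> F \<subseteq> J \<Longrightarrow> norm (sum g F) \<le> c"
      using has_sum_finite_sums_bounded[OF g(2)] by blast
    obtain n :: nat where "c \<le> n"
      using real_arch_simple by blast
    then have "x \<in> ?B n"
      using g c order.trans by (intro bounded_expansionsI) blast+
    then show ?thesis
      using closure_subset[of "?B n"] by blast
  qed
  then have UN: "(\<Union>n. closure (?B n)) = UNIV"
    by blast
  have "\<exists>n. interior (closure (?B n)) \<noteq> {}"
  proof (rule ccontr)
    assume "\<not> ?thesis"
    then have "Met_TC.mtopology interior_of (\<Union>n. closure (?B n)) = {}"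
      by (intro Met_TC.metric_Baire_category_alt) (auto simp: complete_UNIV)
    then show False
      by (simp add: UN)
  qed
  then obtain n where "interior (closure (?B n)) \<noteq> {}"
    by blast
  then obtain x r where "r > 0" and r: "ball x r \<subseteq> closure (?B n)"
    unfolding mem_interior ex_in_conv[symmetric] by blast
  \<comment> \<open>The ball found is centred at \<open>x\<close>. Writing \<open>y\<close> as
    \<open>(x + y) - x\<close> moves the centre to 0 and doubles the bound.\<close>
  have "y \<in> closure (bounded_expansions J W (real n + real n))" if "y \<in> ball 0 r" for y
  proof -
    have "x + y \<in> closure (?B n)" "x \<in> closure (?B n)"
      using r that \<open>r > 0\<close> by (auto simp: subset_iff dist_norm)
    then obtain u v where u: "\<And>k. u k \<in> ?B n" "u \<longlonglongrightarrow> x + y" and v: "\<And>k. v k \<in> ?B n" "v \<longlonglongrightarrow> x"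
      unfolding closure_sequential by metis
    have "u k - v k \<in> bounded_expansions J W (real n + real n)" for k
      by (rule bounded_expansions_diff[OF _ u(1) v(1)]) (rule W)
    moreover have "(\<lambda>k. u k - v k) \<longlonglongrightarrow> y"
      using tendsto_diff[OF u(2) v(2)] by simp
    ultimately show ?thesis
      unfolding closure_sequential by (intro exI[of _ "\<lambda>k. u k - v k"]) simp
  qed
  then show ?thesis
    using that \<open>r > 0\<close> by blast
qed

text \<open>By homogeneity, approximation at a single radius inside the ball gives approximation of
  every vector with relative error 1/2 and a uniform constant. This is one step of the
  iteration.\<close>

lemma bounded_expansions_approx:
  fixes W :: "'j \<Rightarrow> 'h::{real_normed_vector, complete_space} set"
  assumes W: "\<And>j. j \<in> J \<Longrightarrow> subspace (W j)"
    and ex: "\<And>f. \<exists>g. (\<forall>j\<in>J. g j \<in> W j) \<and> (g has_sum f) J"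
  obtains K where "K \<ge> 0"
    "\<And>f. \<exists>h \<in> bounded_expansions J W (K * norm f). norm (f - h) \<le> norm f / 2"
proof -
  obtain c r where "r > 0" and r: "ball 0 r \<subseteq> closure (bounded_expansions J W c)"
    using ball_subset_closure_bounded_expansions[OF W ex] by blast
  have "\<exists>h \<in> bounded_expansions J W (2 * \<bar>c\<bar> / r * norm f). norm (f - h) \<le> norm f / 2" for f
  proof (cases "f = 0")
    case True
    have "(0::'h) \<in> bounded_expansions J W 0"
      by (rule bounded_expansionsI[of _ "\<lambda>_. 0"]) (simp_all add: W subspace_0)
    then show ?thesis
      using True by (intro bexI[of _ 0]) auto
  next
    case False
    \<comment> \<open>With this \<open>t\<close> the vector \<open>f /\<^sub>R t\<close> has norm
      \<open>r / 2\<close>, hence lies in the ball. An error of \<open>r / 4\<close> there becomes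
      \<open>norm f / 2\<close> after scaling back.\<close>
    define t where "t = 2 * norm f / r"
    have t: "t > 0"
      using False \<open>r > 0\<close> by (simp add: t_def)
    have "norm (f /\<^sub>R t) = r / 2"
      using False \<open>r > 0\<close> by (simp add: t_def field_simps)
    then have "f /\<^sub>R t \<in> closure (bounded_expansions J W c)"
      using r \<open>r > 0\<close> by (auto simp: subset_iff)
    moreover have "r / 4 > 0"
      using \<open>r > 0\<close> by simp
    ultimately obtain y where y: "y \<in> bounded_expansions J W c" "dist y (f /\<^sub>R t) < r / 4"
      unfolding closure_approachable by blast
    have "f - t *\<^sub>R y = t *\<^sub>R (f /\<^sub>R t - y)"
      using t by (simp add: scaleR_diff_right)
    then have "norm (f - t *\<^sub>R y) = t * dist y (f /\<^sub>R t)"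
      using t by (simp add: dist_norm norm_minus_commute)
    also have "\<dots> \<le> t * (r / 4)"
      using y t by (intro mult_left_mono) auto
    also have "\<dots> = norm f / 2"
      using \<open>r > 0\<close> by (simp add: t_def)
    finally have "norm (f - t *\<^sub>R y) \<le> norm f / 2" .
    \<comment> \<open>Passing from \<open>c\<close> to its absolute value makes the resulting
      constant \<open>K\<close> nonnegative at once.\<close>
    moreover have "t *\<^sub>R y \<in> bounded_expansions J W (\<bar>t\<bar> * \<bar>c\<bar>)"
      using y(1) bounded_expansions_mono[OF abs_ge_self[of c]] W
      by (intro bounded_expansions_scaleR) blast+
    moreover have "\<bar>t\<bar> * \<bar>c\<bar> = 2 * \<bar>c\<bar> / r * norm f"
      using \<open>r > 0\<close> by (simp add: t_def abs_mult)
    ultimately show ?thesis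
      by metis
  qed
  then show ?thesis
    using that[of "2 * \<bar>c\<bar> / r"] \<open>r > 0\<close> by simp
qed

text \<open>Approximating the successive residuals gives corrections whose expansions are bounded by
  a geometric series, with total \<open>2 * K * norm f\<close>. Closedness of the \<open>W j\<close>
  keeps the limiting coefficients in place.\<close>

lemma expansions_uniformly_bounded:
  fixes W :: "'j \<Rightarrow> 'h::{real_normed_vector, complete_space} set"
  assumes W: "\<And>j. j \<in> J \<Longrightarrow> subspace (W j)" and cl: "\<And>j. j \<in> J \<Longrightarrow> closed (W j)"
    and ex: "\<And>f. \<exists>g. (\<forall>j\<in>J. g j \<in> W j) \<and> (g has_sum f) J"
  obtains M where "\<And>f. f \<in> bounded_expansions J W (M * norm f)"
proof -
  obtain K where "K \<ge> 0" and
    K: "\<And>f. \<exists>h \<in> bounded_expansions J W (K * norm f). norm (f - h) \<le> norm f / 2"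
    using bounded_expansions_approx[OF W ex] by blast
  obtain H where H: "\<And>f. H f \<in> bounded_expansions J W (K * norm f)"
      "\<And>f. norm (f - H f) \<le> norm f / 2"
    using K by metis
  have "\<forall>f. \<exists>g. (\<forall>j\<in>J. g j \<in> W j) \<and> (g has_sum H f) J \<and>
      (\<forall>F. finite F \<and> F \<subseteq> J \<longrightarrow> norm (sum g F) \<le> K * norm f)"
    using H(1) unfolding bounded_expansions_def by simp
  then obtain G where "\<forall>f. (\<forall>j\<in>J. G f j \<in> W j) \<and> (G f has_sum H f) J \<and>
      (\<forall>F. finite F \<and> F \<subseteq> J \<longrightarrow> norm (sum (G f) F) \<le> K * norm f)"
    by (rule choice[THEN exE])
  then have G: "\<And>f j. j \<in> J \<Longrightarrow> G f j \<in> W j" "\<And>f. (G f has_sum H f) J"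
      "\<And>f F. finite F \<Longrightarrow> F \<subseteq> J \<Longrightarrow> norm (sum (G f) F) \<le> K * norm f"
    by simp_all
  have "f \<in> bounded_expansions J W (2 * K * norm f)" for f
  proof -
    \<comment> \<open>\<open>r n\<close> is the residual after \<open>n\<close> corrections. The
      corrections add up to \<open>f - r n\<close>, and \<open>p n\<close> below collects their
      expansions.\<close>
    define r where "r n = ((\<lambda>x. x - H x) ^^ n) f" for n
    have r_Suc: "r (Suc n) = r n - H (r n)" for n
      by (simp add: r_def)
    have norm_r: "norm (r n) \<le> norm f / 2 ^ n" for n
    proof (induction n)
      case (Suc n)
      then show ?case
        using H(2)[of "r n"] by (simp add: r_Suc)
    qed (simp add: r_def)
    define p where "p n j = (\<Sum>k<n. G (r k) j)" for n j
    have s: "(p n has_sum (f - r n)) J" for n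
    proof (induction n)
      case 0
      then show ?case
        by (simp add: p_def r_def)
    next
      case (Suc n)
      have "f - r (Suc n) = (f - r n) + H (r n)" "p (Suc n) = (\<lambda>j. p n j + G (r n) j)"
        by (simp_all add: r_Suc p_def fun_eq_iff)
      then show ?case
        using has_sum_add[OF Suc G(2)[of "r n"]] by metis
    qed
    have "(\<lambda>n. norm f / 2 ^ n) \<longlonglongrightarrow> 0"
      by (rule LIMSEQ_divide_realpow_zero) simp
    then have "r \<longlonglongrightarrow> 0"
      by (rule Lim_null_comparison[rotated]) (simp add: norm_r)
    then have lim: "(\<lambda>n. f - r n) \<longlonglongrightarrow> f"
      using tendsto_diff[OF tendsto_const, of r 0 _ f] by simp
    \<comment> \<open>The geometric tail is written as a difference so that the induction on
      \<open>m\<close> telescopes: passing from \<open>m\<close> to \<open>Suc m\<close> adds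
      exactly \<open>K * norm f / 2 ^ m\<close>.\<close>
    have increment: "norm (sum (p n) F - sum (p m) F) \<le> 2 * K * norm f / 2 ^ n - 2 * K * norm f / 2 ^ m"
      if "n \<le> m" "finite F" "F \<subseteq> J" for n m F
      using \<open>n \<le> m\<close>
    proof (induction m rule: dec_induct)
      case (step m)
      have "sum (p (Suc m)) F = sum (p m) F + sum (G (r m)) F"
        by (simp add: p_def sum.distrib)
      then have "norm (sum (p n) F - sum (p (Suc m)) F) \<le>
          norm (sum (p n) F - sum (p m) F) + norm (sum (G (r m)) F)"
        using norm_triangle_ineq4[of "sum (p n) F - sum (p m) F" "sum (G (r m)) F"]
        by (simp add: algebra_simps)
      moreover have "norm (sum (G (r m)) F) \<le> K * (norm f / 2 ^ m)"
        using G(3)[OF that(2,3), of "r m"] mult_left_mono[OF norm_r[of m] \<open>K \<ge> 0\<close>] by linarith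
      ultimately show ?case
        using step.IH by simp
    qed simp
    have "\<exists>N. \<forall>n\<ge>N. \<forall>m\<ge>n. \<forall>F. finite F \<and> F \<subseteq> J \<longrightarrow> norm (sum (p n) F - sum (p m) F) \<le> e"
      if "e > 0" for e
    proof -
      have "(\<lambda>n. 2 * K * norm f / 2 ^ n) \<longlonglongrightarrow> 0"
        by (rule LIMSEQ_divide_realpow_zero) simp
      then have "\<forall>\<^sub>F n in sequentially. 2 * K * norm f / 2 ^ n < e"
        using order_tendstoD(2) \<open>e > 0\<close> by blast
      then obtain N where N: "\<And>n. n \<ge> N \<Longrightarrow> 2 * K * norm f / 2 ^ n < e"
        unfolding eventually_sequentially by blast
      moreover have "2 * K * norm f / 2 ^ m \<ge> 0" for m
        using \<open>K \<ge> 0\<close> by simp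
      ultimately show ?thesis
        using increment by (smt (verit))
    qed
    then obtain g where g: "(g has_sum f) J" "\<And>j. j \<in> J \<Longrightarrow> (\<lambda>n. p n j) \<longlonglongrightarrow> g j"
      by (rule has_sum_limit_of_uniformly_Cauchy[OF s lim]) (assumption, rule that)
    have "p n j \<in> W j" if "j \<in> J" for n j
      unfolding p_def using G(1) W that by (intro subspace_sum) auto
    then have "g j \<in> W j" if "j \<in> J" for j
      using closed_sequentially[of "W j" "\<lambda>n. p n j" "g j"] cl g(2) that by blast
    moreover have "norm (sum g F) \<le> 2 * K * norm f" if F: "finite F" "F \<subseteq> J" for F
    proof (rule Lim_bounded[OF tendsto_norm])
      show "(\<lambda>n. sum (p n) F) \<longlonglongrightarrow> sum g F"
        using g F by (intro tendsto_sum) auto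
      have "2 * K * norm f / 2 ^ m \<ge> 0" for m
        using \<open>K \<ge> 0\<close> by simp
      \<comment> \<open>Since \<open>p 0\<close> vanishes, the increment from 0 to \<open>n\<close>
        bounds the partial sums of \<open>p n\<close> themselves.\<close>
      then show "\<forall>n\<ge>0. norm (sum (p n) F) \<le> 2 * K * norm f"
        using increment[OF _ F, of 0] by (simp add: p_def) (smt (verit))
    qed
    ultimately show ?thesis
      using g(1) by (intro bounded_expansionsI)
  qed
  then show ?thesis
    using that by blast
qed

section \<open>From an f-basis to the inequality\<close>

lemma f_basis_imp_bounded_partial_sums:
  fixes W :: "'j \<Rightarrow> 'h::{real_normed_vector, complete_space} set"
  assumes W: "\<And>j. j \<in> J \<Longrightarrow> subspace (W j)" and cl: "\<And>j. j \<in> J \<Longrightarrow> closed (W j)"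
    and ex1: "\<And>f. \<exists>!g. g \<in> (\<Pi>\<^sub>E j\<in>J. W j) \<and> (g has_sum f) J"
  shows "\<exists>M. \<forall>F G g. finite G \<and> F \<subseteq> G \<and> G \<subseteq> J \<and> (\<forall>j\<in>G. g j \<in> W j) \<longrightarrow>
      norm (sum g F) \<le> M * norm (sum g G)"
proof -
  have "\<exists>g. (\<forall>j\<in>J. g j \<in> W j) \<and> (g has_sum f) J" for f
    using ex1[of f] by (auto simp: PiE_iff)
  then obtain M where M: "\<And>f. f \<in> bounded_expansions J W (M * norm f)"
    using expansions_uniformly_bounded[of J W, OF W cl] by metis
  have "norm (sum g F) \<le> M * norm (sum g G)"
    if G: "finite G" "F \<subseteq> G" "G \<subseteq> J" "\<forall>j\<in>G. g j \<in> W j" for F G g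
  proof -
    obtain h where h: "\<And>j. j \<in> J \<Longrightarrow> h j \<in> W j" "(h has_sum (sum g G)) J"
        "\<And>F. finite F \<Longrightarrow> F \<subseteq> J \<Longrightarrow> norm (sum h F) \<le> M * norm (sum g G)"
      using M[of "sum g G"] by (rule bounded_expansionsE) blast
    \<comment> \<open>Padding by 0 turns the finite sum into an expansion over all of
      \<open>J\<close>, to be compared with the bounded expansion \<open>h\<close>. Restricting both
      to \<open>J\<close> puts them into \<open>PiE\<close>, where uniqueness applies.\<close>
    define g0 where "g0 j = (if j \<in> G then g j else 0)" for j
    have "(g0 has_sum (sum g G)) J"
      using G by (intro has_sum_finite_neutralI[of G]) (auto simp: g0_def)
    then have "restrict g0 J \<in> (\<Pi>\<^sub>E j\<in>J. W j) \<and> (restrict g0 J has_sum (sum g G)) J"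
      using G W has_sum_cong[of J "restrict g0 J" g0] by (auto simp: g0_def subspace_0)
    moreover have "restrict h J \<in> (\<Pi>\<^sub>E j\<in>J. W j) \<and> (restrict h J has_sum (sum g G)) J"
      using h has_sum_cong[of J "restrict h J" h] by auto
    ultimately have eq: "restrict g0 J = restrict h J"
      using ex1[of "sum g G"] by blast
    have "g j = h j" if "j \<in> F" for j
    proof -
      have "j \<in> G" "j \<in> J"
        using that G by auto
      then show ?thesis
        using fun_cong[OF eq, of j] by (simp add: g0_def)
    qed
    then have "sum g F = sum h F"
      by simp
    then show ?thesis
      using h(3)[of F] G by (metis finite_subset order.trans)
  qed
  then show ?thesis
    by blast
qed

section \<open>From the inequality to an f-basis\<close>

text \<open>Adding a multiple of a vector of \<open>W i\<close> changes only the coefficient at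
  \<open>i\<close>. Requiring \<open>p\<close> to vanish off \<open>G\<close> makes it an expansion
  over \<open>J\<close>, and its sum is the same over every finite set containing
  \<open>G\<close>.\<close>

lemma (in vector_space) span_UN_finite_sum:
  assumes W: "\<And>j. j \<in> J \<Longrightarrow> subspace (W j)" and "x \<in> span (\<Union>j\<in>J. W j)"
  shows "\<exists>G p. finite G \<and> G \<subseteq> J \<and> (\<forall>j\<in>J. p j \<in> W j) \<and> (\<forall>j. j \<notin> G \<longrightarrow> p j = 0) \<and> x = sum p G"
  using assms(2)
proof (induction rule: span_induct_alt)
  case base
  then show ?case
    using W by (intro exI[of _ "{}"] exI[of _ "\<lambda>_. 0"]) (auto intro: subspace_0)
next
  case (step c x y)
  then obtain i where i: "i \<in> J" "x \<in> W i"
    by blast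
  obtain G p where G: "finite G" "G \<subseteq> J" "\<forall>j\<in>J. p j \<in> W j" "\<forall>j. j \<notin> G \<longrightarrow> p j = 0" "y = sum p G"
    using step.IH by blast
  \<comment> \<open>The index \<open>i\<close> may or may not lie in \<open>G\<close>. As
    \<open>p\<close> vanishes off \<open>G\<close>, adding to the old coefficient is correct in both
    cases.\<close>
  let ?q = "\<lambda>j. (if j = i then scale c x else 0) + p j"
  have "sum p (insert i G) = y"
    using G by (intro trans[OF sum.mono_neutral_right[of "insert i G" G]]) auto
  then have "scale c x + y = sum ?q (insert i G)"
    using G(1) by (simp add: sum.distrib del: sum.insert)
  moreover have "?q j \<in> W j" if "j \<in> J" for j
    using that G(3) i W by (auto intro!: subspace_add subspace_scale)
  ultimately show ?case
    using G i by (intro exI[of _ "insert i G"] exI[of _ ?q]) auto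
qed

text \<open>Density is stated with finite sums instead of a span, so that only the real structure
  occurs and the lemma serves every scalar field.\<close>

lemma bounded_partial_sums_ex1_expansion:
  fixes W :: "'j \<Rightarrow> 'h::{real_normed_vector, complete_space} set"
  assumes W: "\<And>j. j \<in> J \<Longrightarrow> subspace (W j)" and cl: "\<And>j. j \<in> J \<Longrightarrow> closed (W j)"
    and dense: "closure {x. \<exists>G p. finite G \<and> G \<subseteq> J \<and> (\<forall>j\<in>J. p j \<in> W j) \<and>
      (\<forall>j. j \<notin> G \<longrightarrow> p j = 0) \<and> x = sum p G} = UNIV"
    and M: "\<And>F G g. finite G \<Longrightarrow> F \<subseteq> G \<Longrightarrow> G \<subseteq> J \<Longrightarrow> (\<And>j. j \<in> G \<Longrightarrow> g j \<in> W j) \<Longrightarrow>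
      norm (sum g F) \<le> M * norm (sum g G)"
  shows "\<exists>!g. g \<in> (\<Pi>\<^sub>E j\<in>J. W j) \<and> (g has_sum f) J"
proof -
  have "f \<in> closure {x. \<exists>G p. finite G \<and> G \<subseteq> J \<and> (\<forall>j\<in>J. p j \<in> W j) \<and>
      (\<forall>j. j \<notin> G \<longrightarrow> p j = 0) \<and> x = sum p G}"
    unfolding dense by (rule UNIV_I)
  then obtain s where s: "\<And>n. \<exists>G p. finite G \<and> G \<subseteq> J \<and> (\<forall>j\<in>J. p j \<in> W j) \<and>
      (\<forall>j. j \<notin> G \<longrightarrow> p j = 0) \<and> s n = sum p G" and lim: "s \<longlonglongrightarrow> f"
    unfolding closure_sequential mem_Collect_eq by blast
  from s obtain G p where G: "\<And>n. finite (G n)" "\<And>n. G n \<subseteq> J" and p: "\<And>n j. j \<in> J \<Longrightarrow> p n j \<in> W j"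
      "\<And>n j. j \<notin> G n \<Longrightarrow> p n j = 0" "\<And>n. s n = sum (p n) (G n)"
    by metis
  have increment: "norm (sum (p n) F - sum (p m) F) \<le> M * norm (s n - s m)" if F: "finite F" "F \<subseteq> J" for n m F
  proof -
    \<comment> \<open>A common finite set containing \<open>F\<close> and both supports: the family
      \<open>p n - p m\<close> sums over it to \<open>s n - s m\<close>, so the hypothesis bounds
      its sum over \<open>F\<close>.\<close>
    let ?A = "F \<union> G n \<union> G m"
    have "norm (\<Sum>j\<in>F. p n j - p m j) \<le> M * norm (\<Sum>j\<in>?A. p n j - p m j)"
    proof (rule M)
      show "p n j - p m j \<in> W j" if "j \<in> ?A" for j
      proof -
        have "j \<in> J"
          using that F(2) G(2) by blast
        then show ?thesis
          using W p(1) by (intro subspace_diff)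
      qed
    qed (use F G in auto)
    moreover have "sum (p n) ?A = s n" "sum (p m) ?A = s m"
      unfolding p(3) using F(1) G(1) p(2) by (intro sum.mono_neutral_right; auto)+
    ultimately show ?thesis
      by (simp add: sum_subtractf)
  qed
  have sum_p: "(p n has_sum s n) J" for n
    using G p by (intro has_sum_finite_neutralI[of "G n"]) auto
  have "\<exists>N. \<forall>n\<ge>N. \<forall>m\<ge>n. \<forall>F. finite F \<and> F \<subseteq> J \<longrightarrow> norm (sum (p n) F - sum (p m) F) \<le> e"
    if "e > 0" for e
  proof -
    \<comment> \<open>\<open>M\<close> is an arbitrary real, possibly 0 or negative; \<bar>M\<bar> +
      1 is a positive upper bound for it.\<close>
    have "e / (\<bar>M\<bar> + 1) > 0"
      using \<open>e > 0\<close> by simp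
    then obtain N where N: "\<And>n m. n \<ge> N \<Longrightarrow> m \<ge> N \<Longrightarrow> norm (s n - s m) < e / (\<bar>M\<bar> + 1)"
      using LIMSEQ_imp_Cauchy[OF lim] unfolding Cauchy_iff by metis
    have "norm (sum (p n) F - sum (p m) F) \<le> e" if "n \<ge> N" "m \<ge> n" "finite F" "F \<subseteq> J" for n m F
    proof -
      have "norm (sum (p n) F - sum (p m) F) \<le> M * norm (s n - s m)"
        using increment that by blast
      also have "\<dots> \<le> (\<bar>M\<bar> + 1) * norm (s n - s m)"
        by (intro mult_right_mono) auto
      also have "\<dots> \<le> (\<bar>M\<bar> + 1) * (e / (\<bar>M\<bar> + 1))"
        using N[of n m] that by (intro mult_left_mono) auto
      finally show ?thesis
        by (simp add: add_nonneg_eq_0_iff)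
    qed
    then show ?thesis
      by blast
  qed
  then obtain g where g: "(g has_sum f) J" "\<And>j. j \<in> J \<Longrightarrow> (\<lambda>n. p n j) \<longlonglongrightarrow> g j"
    by (rule has_sum_limit_of_uniformly_Cauchy[OF sum_p lim]) (assumption, rule that)
  have "g j \<in> W j" if "j \<in> J" for j
    using closed_sequentially[of "W j" "\<lambda>n. p n j" "g j"] cl g(2) p(1) that by blast
  then have "restrict g J \<in> (\<Pi>\<^sub>E j\<in>J. W j) \<and> (restrict g J has_sum f) J"
    using g has_sum_cong[of J "restrict g J" g] by auto
  moreover have "u = v"
    if u: "u \<in> (\<Pi>\<^sub>E j\<in>J. W j) \<and> (u has_sum f) J" and v: "v \<in> (\<Pi>\<^sub>E j\<in>J. W j) \<and> (v has_sum f) J" for u v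
  proof (rule PiE_ext)
    fix i
    assume i: "i \<in> J"
    \<comment> \<open>\<open>d\<close> is an expansion of 0 with coefficients in the
      \<open>W j\<close>. Comparing its coefficient at \<open>i\<close> with its sums over finite
      sets containing \<open>i\<close> forces that coefficient to be 0.\<close>
    define d where "d j = u j + - v j" for j
    have "(d has_sum (f + - f)) J"
      unfolding d_def using u v by (intro has_sum_add) (simp_all add: has_sum_uminus)
    then have "(sum d \<longlongrightarrow> 0) (finite_subsets_at_top J)"
      by (simp add: has_sum_def)
    then have "((\<lambda>F. M * norm (sum d F)) \<longlongrightarrow> M * norm (0::'h)) (finite_subsets_at_top J)"
      by (intro tendsto_intros)
    moreover have "d j \<in> W j" if "j \<in> J" for j
      using u v W that by (auto simp: d_def PiE_iff intro: subspace_diff)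
    then have "norm (d i) \<le> M * norm (sum d F)" if "finite F" "{i} \<subseteq> F" "F \<subseteq> J" for F
      using M[of F "{i}" d] that by auto
    then have "\<forall>\<^sub>F F in finite_subsets_at_top J. norm (d i) \<le> M * norm (sum d F)"
      unfolding eventually_finite_subsets_at_top using i by (intro exI[of _ "{i}"]) auto
    ultimately have "norm (d i) \<le> M * norm (0::'h)"
      by (rule tendsto_lowerbound) simp
    then show "u i = v i"
      by (simp add: d_def)
  qed (use u v in auto)
  ultimately show ?thesis
    by blast
qed

section \<open>The equivalence over the scalar field\<close>

theorem theorem2p8:
  fixes scl :: "'k::real_normed_field \<Rightarrow> 'h::{real_inner, complete_space} \<Rightarrow> 'h"
    and J :: "'j set" and W :: "'j \<Rightarrow> 'h set"
  assumes "hilbert_space scl"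
    and "separable_space (euclidean :: 'h topology)"
    and "countable J"
    and "\<And>j. j \<in> J \<Longrightarrow> closed_subspace scl (W j)"
    and "complete_family scl J W"
  shows "f_basis scl J W \<longleftrightarrow>
    (\<exists>M::real. \<forall>F G g. finite G \<and> F \<subseteq> G \<and> G \<subseteq> J \<and> (\<forall>j\<in>G. g j \<in> W j) \<longrightarrow>
      norm (\<Sum>j\<in>F. g j) \<le> M * norm (\<Sum>j\<in>G. g j))"
proof -
  interpret hilbert_space scl
    by fact
  have W: "subspace (W j)" and cl: "closed (W j)" if "j \<in> J" for j
    using assms(4)[OF that] by (auto simp: closed_subspace_def)
  \<comment> \<open>Real scaling is \<open>scl\<close> applied to real scalars, so the lemmas on
    real subspaces apply to the \<open>W j\<close>.\<close>
  have real_subspace: "Real_Vector_Spaces.subspace (W j)" if "j \<in> J" for j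
    unfolding Real_Vector_Spaces.subspace_def
    using W[OF that] by (metis scale_of_real subspace_0 subspace_add subspace_scale)
  show ?thesis
  proof
    assume "f_basis scl J W"
    then show "\<exists>M::real. \<forall>F G g. finite G \<and> F \<subseteq> G \<and> G \<subseteq> J \<and> (\<forall>j\<in>G. g j \<in> W j) \<longrightarrow>
      norm (\<Sum>j\<in>F. g j) \<le> M * norm (\<Sum>j\<in>G. g j)"
      unfolding f_basis_def
      by (intro f_basis_imp_bounded_partial_sums[OF real_subspace cl]) blast+
  next
    assume "\<exists>M::real. \<forall>F G g. finite G \<and> F \<subseteq> G \<and> G \<subseteq> J \<and> (\<forall>j\<in>G. g j \<in> W j) \<longrightarrow>
      norm (\<Sum>j\<in>F. g j) \<le> M * norm (\<Sum>j\<in>G. g j)"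
    then obtain M where M: "\<And>F G g. finite G \<Longrightarrow> F \<subseteq> G \<Longrightarrow> G \<subseteq> J \<Longrightarrow> (\<And>j. j \<in> G \<Longrightarrow> g j \<in> W j) \<Longrightarrow>
      norm (sum g F) \<le> M * norm (sum g G)"
      by metis
    let ?S = "{x. \<exists>G p. finite G \<and> G \<subseteq> J \<and> (\<forall>j\<in>J. p j \<in> W j) \<and>
      (\<forall>j. j \<notin> G \<longrightarrow> p j = 0) \<and> x = sum p G}"
    \<comment> \<open>Finite sums contain the span over the scalar field, and a superset of a dense
      set is dense.\<close>
    have "span (\<Union>j\<in>J. W j) \<subseteq> ?S"
      using W by (auto intro!: span_UN_finite_sum simp del: ex_simps)
    then have "closure ?S = UNIV"
      using assms(5) closure_mono[of "span (\<Union>j\<in>J. W j)" ?S]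
      unfolding complete_family_def by (simp only: top.extremum_unique)
    then show "f_basis scl J W"
      unfolding f_basis_def using assms(4)
      by (intro conjI ballI allI bounded_partial_sums_ex1_expansion[OF real_subspace cl _ M])
  qed
qed

end
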